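(* Let $n\ge 1$ and let $a$ be any $n$-prime. Then the prime $p_{n+1}$ divides one and only one of the $n$-primes in the series $$K\cdot\prod_{1\le i\le n}p_i + a,\qquad 0\le K\le p_{n+1}-1 .$$
   Context: $p_i$ denotes the $i$-th prime number ($p_1=2$, $p_2=3$, $p_3=5,\dots$). An integer is called an $n$-prime if it is not divisible by any of the first $n$ primes $p_1,\dots,p_n$. $K$ ranges over integers. *)

theory Defs
  imports "HOL-Computational_Algebra.Primes" "HOL-Library.Infinite_Set"
begin

(* Indexing starts at 1: nth_prime 1 = 2, nth_prime 2 = 3, ...;
   the value at 0 is irrelevant (it is also 2). *)
definition nth_prime :: "nat \<Rightarrow> nat" where
  "nth_prime i = enumerate {p::nat. prime p} (i - 1)"

(* Defined on all integers, negative ones included; an n-prime need not be prime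
   (for example 1 is an n-prime for every n). *)
definition n_prime :: "nat \<Rightarrow> int \<Rightarrow> bool" where
  "n_prime n a \<longleftrightarrow> (\<forall>i\<in>{1..n}. \<not> int (nth_prime i) dvd a)"

end

theory Submission
  imports Defs "HOL-Number_Theory.Cong"
begin

text \<open>Let P be the product of the first n primes and q the next prime. Adding a multiple of P
  to \<open>a\<close> leaves its residues modulo those n primes unchanged, so every term of the
  series is again an n-prime (\<open>n_prime_add_multiple\<close>). As q is coprime to P
  (\<open>coprime_prod_nth_prime\<close>), the map K \<mapsto> K * P + a permutes the residues
  modulo q; hence exactly one K in a complete residue system gives 0
  (\<open>ex1_residue_dvd_linear\<close>).\<close>

lemma prime_nth_prime: "prime (nth_prime i)"
  using enumerate_in_set[OF primes_infinite, of "i - 1"] by (simp add: nth_prime_def)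

text \<open>The bound \<open>1 \<le> i\<close> matters: by truncated subtraction
  \<open>nth_prime 0\<close> equals \<open>nth_prime 1\<close>.\<close>

lemma nth_prime_less:
  assumes "1 \<le> i" "i < j"
  shows "nth_prime i < nth_prime j"
  unfolding nth_prime_def
  by (rule enumerate_mono) (use assms primes_infinite in auto)

lemma coprime_prod_nth_prime:
  "coprime (\<Prod>i\<in>{1..n}. int (nth_prime i)) (int (nth_prime (n + 1)))"
proof (rule prod_coprime_left)
  fix i assume "i \<in> {1..n}"
  then have "nth_prime i \<noteq> nth_prime (n + 1)"
    using nth_prime_less[of i "n + 1"] by simp
  then show "coprime (int (nth_prime i)) (int (nth_prime (n + 1)))"
    using primes_coprime[OF prime_nth_prime prime_nth_prime] by simp
qed

lemma n_prime_add_multiple: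
  assumes "n_prime n a"
  shows "n_prime n (K * (\<Prod>i\<in>{1..n}. int (nth_prime i)) + a)"
  unfolding n_prime_def
proof
  fix i assume i: "i \<in> {1..n}"
  then have "int (nth_prime i) dvd K * (\<Prod>i\<in>{1..n}. int (nth_prime i))"
    by (intro dvd_mult dvd_prodI) auto
  then show "\<not> int (nth_prime i) dvd K * (\<Prod>i\<in>{1..n}. int (nth_prime i)) + a"
    using assms i by (simp add: n_prime_def dvd_add_right_iff)
qed

text \<open>P is invertible modulo q, so the divisibility fixes K modulo q as -a times that inverse,
  and the integers from 0 to q - 1 represent each class once.\<close>

lemma ex1_residue_dvd_linear:
  fixes P q a :: int
  assumes "coprime P q" "q > 0"
  shows "\<exists>!K. 0 \<le> K \<and> K \<le> q - 1 \<and> q dvd K * P + a"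
proof (rule ex_ex1I)
  obtain x where x: "[P * x = 1] (mod q)"
    using cong_solve_coprime_int[OF assms(1)] by blast
  \<comment> \<open>Solves K * P = -a modulo q by means of the inverse \<open>x\<close> of P; the
    outer \<open>mod\<close> brings the solution into the required range.\<close>
  define K where "K = (- a * x) mod q"
  have "[K * P = (- a * x) * P] (mod q)"
    unfolding K_def by (intro cong_scalar_right) simp
  also have "(- a * x) * P = - a * (P * x)"
    by (simp add: algebra_simps)
  also have "[- a * (P * x) = - a * 1] (mod q)"
    by (rule cong_scalar_left[OF x])
  finally have "q dvd K * P + a"
    by (simp add: cong_iff_dvd_diff)
  moreover have "0 \<le> K" "K \<le> q - 1"
    using assms(2) pos_mod_bound[of q "- a * x"] by (simp_all add: K_def)
  ultimately show "\<exists>K. 0 \<le> K \<and> K \<le> q - 1 \<and> q dvd K * P + a"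
    by blast
next
  fix K L
  assume K: "0 \<le> K \<and> K \<le> q - 1 \<and> q dvd K * P + a"
    and L: "0 \<le> L \<and> L \<le> q - 1 \<and> q dvd L * P + a"
  then have "q dvd (K * P + a) - (L * P + a)"
    by (blast intro: dvd_diff)
  then have "[K * P = L * P] (mod q)"
    by (simp add: cong_iff_dvd_diff)
  \<comment> \<open>P cancels because it is coprime to q; the bounds then turn congruence into
    equality.\<close>
  then have "[K = L] (mod q)"
    using assms(1) by (simp add: cong_mult_rcancel coprime_commute)
  then show "K = L"
    using K L by (intro cong_less_imp_eq_int) auto
qed

theorem theorem5:
  fixes n :: nat and a :: int
  assumes "n \<ge> 1" and "n_prime n a"
  shows "\<exists>!K::int. 0 \<le> K \<and> K \<le> int (nth_prime (n + 1)) - 1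
           \<and> n_prime n (K * (\<Prod>i\<in>{1..n}. int (nth_prime i)) + a)
           \<and> int (nth_prime (n + 1)) dvd K * (\<Prod>i\<in>{1..n}. int (nth_prime i)) + a"
  using ex1_residue_dvd_linear[OF coprime_prod_nth_prime, of n a]
    n_prime_add_multiple[OF assms(2)] prime_gt_0_nat[OF prime_nth_prime, of "n + 1"]
  by simp

end
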